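(* Let $\mathbb{T}$ be a time scale, $a,b\in\mathbb{T}$ with $a<b$, $t\in(a,b]_{\mathbb{T}}$, and $0\le\alpha\le 1$. Let $w,f,g\in C([a,b]_{\mathbb{T}},\mathbb{R})$ be diamond-$\alpha$ integrable functions and let $K:[a,b]_{\mathbb{T}}\times[a,b]_{\mathbb{T}}\to[0,\infty)$ be a nonnegative kernel. Let $p,q>1$ with $\frac1p+\frac1q=1$. Assume that all the integrals appearing below exist and are finite, and that \[ A(t):=\mathcal{I}_{K}^{\alpha}(|w||f|^p)(t)>0,\qquad B(t):=\mathcal{I}_{K}^{\alpha}(|w||g|^q)(t)>0. \] Then, with $\beta=\min\{\frac1p,\frac1q\}$ and $\gamma=\max\{\frac1p,\frac1q\}$, \[ \begin{aligned} &2\beta\Big[\sqrt{A(t)B(t)}-\mathcal{I}_{K}^{\alpha}\big(|w||f|^{p/2}|g|^{q/2}\big)(t)\Big]A(t)^{\frac1p-\frac12}B(t)^{\frac1q-\frac12}\\ &\leq A(t)^{1/p}B(t)^{1/q}-\mathcal{I}_{K}^{\alpha}(|w||f||g|)(t)\\ &\leq 2\gamma\Big[\sqrt{A(t)B(t)}-\mathcal{I}_{K}^{\alpha}\big(|w||f|^{p/2}|g|^{q/2}\big)(t)\Big]A(t)^{\frac1p-\frac12}B(t)^{\frac1q-\frac12}. \end{aligned} \]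
   Context: A time scale $\mathbb{T}$ is a nonempty closed subset of $\mathbb{R}$. For $a,b\in\mathbb{T}$, $[a,b]_{\mathbb{T}}=[a,b]\cap\mathbb{T}$ and $(a,b]_{\mathbb{T}}=(a,b]\cap\mathbb{T}$. For $0\le\alpha\le1$ and $h$ delta and nabla integrable on $[a,b]_{\mathbb{T}}$, the diamond-$\alpha$ integral is \[ \int_a^b h(s)\diamond_\alpha s=\alpha\int_a^b h(s)\,\Delta s+(1-\alpha)\int_a^b h(s)\,\nabla s, \] where $\int\cdot\,\Delta s$ and $\int\cdot\,\nabla s$ are the usual delta and nabla integrals of time scale calculus. For a nonnegative kernel $K:[a,b]_{\mathbb{T}}\times[a,b]_{\mathbb{T}}\to[0,\infty)$ and a suitable function $h:[a,b]_{\mathbb{T}}\to\mathbb{R}$, the kernel-type diamond-$\alpha$ integral operator is \[ \mathcal{I}_{K}^{\alpha}h(t)=\int_a^t K(t,s)h(s)\diamond_\alpha s, \] provided that the integral exists and is finite. An expression such as $|w||f|^p$ denotes the function $s\mapsto|w(s)||f(s)|^p$. *)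

theory Defs
  imports "HOL-Analysis.Analysis"
begin

definition time_scale :: "real set \<Rightarrow> bool" where
  "time_scale T \<longleftrightarrow> closed T \<and> T \<noteq> {}"

text \<open>
  The delta and nabla integrals are the Lebesgue integrals for the Lebesgue delta- and
  nabla-measure of time scale calculus. These measures are the Caratheodory extensions of the set
  functions assigning the length \<open>d - c\<close> to \<open>[c, d)\<close> intersected with \<open>T\<close>, respectively
  to \<open>(c, d]\<close> intersected with \<open>T\<close>, for \<open>c \<le> d\<close> in \<open>T\<close>.
  Functions on subsets of \<open>T\<close> are represented by functions on the reals, whose values
  outside \<open>T\<close> are irrelevant.
\<close>

text \<open>
  The parameter \<open>J\<close> is the type of half-open interval used for the coverings. A set that has
  no covering gets the outer measure \<open>\<infinity>\<close>, the infimum of the empty set.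
\<close>

definition ts_covers ::
    "(real \<Rightarrow> real \<Rightarrow> real set) \<Rightarrow> real set \<Rightarrow> real set \<Rightarrow> (nat \<Rightarrow> real \<times> real) set" where
  "ts_covers J T E =
     {I. (\<forall>j. fst (I j) \<in> T \<and> snd (I j) \<in> T \<and> fst (I j) \<le> snd (I j)) \<and>
         E \<subseteq> (\<Union>j. J (fst (I j)) (snd (I j)))}"

definition ts_outer :: "(real \<Rightarrow> real \<Rightarrow> real set) \<Rightarrow> real set \<Rightarrow> real set \<Rightarrow> ennreal" where
  "ts_outer J T E = (INF I \<in> ts_covers J T E. \<Sum>j. ennreal (snd (I j) - fst (I j)))"

definition ts_measure :: "(real \<Rightarrow> real \<Rightarrow> real set) \<Rightarrow> real set \<Rightarrow> real measure" where
  "ts_measure J T = measure_of T (lambda_system T (Pow T) (ts_outer J T)) (ts_outer J T)"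

definition delta_measure :: "real set \<Rightarrow> real measure" where
  "delta_measure = ts_measure (\<lambda>c d. {c..<d})"

definition nabla_measure :: "real set \<Rightarrow> real measure" where
  "nabla_measure = ts_measure (\<lambda>c d. {c<..d})"

text \<open>All integrals below are used only with \<open>a \<le> b\<close>.\<close>

definition delta_integrable :: "real set \<Rightarrow> real \<Rightarrow> real \<Rightarrow> (real \<Rightarrow> real) \<Rightarrow> bool" where
  "delta_integrable T a b h \<longleftrightarrow> set_integrable (delta_measure T) ({a..<b} \<inter> T) h"

definition delta_integral :: "real set \<Rightarrow> real \<Rightarrow> real \<Rightarrow> (real \<Rightarrow> real) \<Rightarrow> real" where
  "delta_integral T a b h = set_lebesgue_integral (delta_measure T) ({a..<b} \<inter> T) h"

definition nabla_integrable :: "real set \<Rightarrow> real \<Rightarrow> real \<Rightarrow> (real \<Rightarrow> real) \<Rightarrow> bool" where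
  "nabla_integrable T a b h \<longleftrightarrow> set_integrable (nabla_measure T) ({a<..b} \<inter> T) h"

definition nabla_integral :: "real set \<Rightarrow> real \<Rightarrow> real \<Rightarrow> (real \<Rightarrow> real) \<Rightarrow> real" where
  "nabla_integral T a b h = set_lebesgue_integral (nabla_measure T) ({a<..b} \<inter> T) h"

definition diamond_integrable :: "real set \<Rightarrow> real \<Rightarrow> real \<Rightarrow> (real \<Rightarrow> real) \<Rightarrow> bool" where
  "diamond_integrable T a b h \<longleftrightarrow> delta_integrable T a b h \<and> nabla_integrable T a b h"

definition diamond_integral ::
    "real set \<Rightarrow> real \<Rightarrow> real \<Rightarrow> real \<Rightarrow> (real \<Rightarrow> real) \<Rightarrow> real" where
  "diamond_integral T \<alpha> a b h = \<alpha> * delta_integral T a b h + (1 - \<alpha>) * nabla_integral T a b h"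

definition kernel_op_exists ::
    "real set \<Rightarrow> (real \<Rightarrow> real \<Rightarrow> real) \<Rightarrow> real \<Rightarrow> (real \<Rightarrow> real) \<Rightarrow> real \<Rightarrow> bool" where
  "kernel_op_exists T K a h t \<longleftrightarrow> diamond_integrable T a t (\<lambda>s. K t s * h s)"

definition kernel_op ::
    "real set \<Rightarrow> real \<Rightarrow> (real \<Rightarrow> real \<Rightarrow> real) \<Rightarrow> real \<Rightarrow> (real \<Rightarrow> real) \<Rightarrow> real \<Rightarrow> real" where
  "kernel_op T \<alpha> K a h t = diamond_integral T \<alpha> a t (\<lambda>s. K t s * h s)"

text \<open>
  The rest of this theory checks that \<open>delta_measure T\<close> and \<open>nabla_measure T\<close> do extend
  the length of half-open intervals.
\<close>

lemma ts_outer_mono: "E \<subseteq> F \<Longrightarrow> ts_outer J T E \<le> ts_outer J T F"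
  unfolding ts_outer_def by (rule INF_superset_mono) (auto simp: ts_covers_def)

lemma ts_outer_le:
  "I \<in> ts_covers J T E \<Longrightarrow> ts_outer J T E \<le> (\<Sum>j. ennreal (snd (I j) - fst (I j)))"
  unfolding ts_outer_def by (rule INF_lower)

lemma ts_outer_J_le:
  assumes "c \<in> T" "d \<in> T" "c \<le> d"
  shows "ts_outer J T (J c d \<inter> T) \<le> ennreal (d - c)"
proof -
  let ?I = "\<lambda>j::nat. if j = 0 then (c, d) else (c, c)"
  have "?I \<in> ts_covers J T (J c d \<inter> T)"
    using assms by (auto simp: ts_covers_def intro!: exI[of _ 0])
  then have "ts_outer J T (J c d \<inter> T) \<le> (\<Sum>j. ennreal (snd (?I j) - fst (?I j)))"
    by (rule ts_outer_le)
  also have "\<dots> = ennreal (d - c)"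
    by (subst suminf_finite[of "{0}"]) auto
  finally show ?thesis .
qed

lemma ts_outer_empty:
  assumes "T \<noteq> {}" "\<forall>c. J c c = {}"
  shows "ts_outer J T {} = 0"
proof -
  obtain c where "c \<in> T" using assms by auto
  from ts_outer_J_le[OF this this, of J] show ?thesis
    using assms(2) by simp
qed

lemma ts_outer_countably_subadditive: "ts_outer J T (\<Union>i. A i) \<le> (\<Sum>i. ts_outer J T (A i))"
proof (rule ennreal_le_epsilon)
  fix e :: real
  assume fin: "(\<Sum>i. ts_outer J T (A i)) < top" and e: "e > 0"
  let ?len = "\<lambda>x::real \<times> real. ennreal (snd x - fst x)"
  have "\<exists>I \<in> ts_covers J T (A i). (\<Sum>j. ?len (I j)) < ts_outer J T (A i) + ennreal (e * (1/2) ^ Suc i)"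
    for i
  proof (rule INF_approx_ennreal)
    show "ts_outer J T (A i) \<noteq> \<infinity>"
      using fin ennreal_suminf_lessD[OF fin, of i] by auto
  qed (use e in \<open>auto simp: ts_outer_def\<close>)
  then obtain I where I: "\<And>i. I i \<in> ts_covers J T (A i)"
    "\<And>i. (\<Sum>j. ?len (I i j)) < ts_outer J T (A i) + ennreal (e * (1/2) ^ Suc i)"
    by metis
  let ?I = "\<lambda>k. I (fst (prod_decode k)) (snd (prod_decode k))"
  have "x \<in> (\<Union>k. J (fst (?I k)) (snd (?I k)))" if x: "x \<in> A i" for x i
  proof -
    have "x \<in> (\<Union>j. J (fst (I i j)) (snd (I i j)))"
      using I(1)[of i] x by (auto simp: ts_covers_def)
    then obtain j where "x \<in> J (fst (I i j)) (snd (I i j))" by blast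
    then show ?thesis
      by (intro UN_I[of "prod_encode (i, j)"]) auto
  qed
  then have "?I \<in> ts_covers J T (\<Union>i. A i)"
    using I(1) by (auto simp: ts_covers_def)
  then have "ts_outer J T (\<Union>i. A i) \<le> (\<Sum>k. ?len (?I k))"
    by (rule ts_outer_le)
  also have "\<dots> = (\<Sum>k. (\<lambda>(i, j). ?len (I i j)) (prod_decode k))"
    by (simp add: case_prod_beta)
  also have "\<dots> = (\<Sum>i. \<Sum>j. ?len (I i j))"
    by (rule suminf_ennreal_2dimen) simp
  also have "\<dots> \<le> (\<Sum>i. ts_outer J T (A i) + ennreal (e * (1/2) ^ Suc i))"
    using I(2) by (intro suminf_le) (auto intro: less_imp_le)
  also have "\<dots> = (\<Sum>i. ts_outer J T (A i)) + (\<Sum>i. ennreal (e * (1/2) ^ Suc i))"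
    by (rule suminf_add[symmetric]) auto
  also have "(\<Sum>i. ennreal (e * (1/2) ^ Suc i)) = ennreal e"
    using sums_mult[OF power_half_series, of e] e
    by (intro suminf_ennreal_eq) auto
  finally show "ts_outer J T (\<Union>i. A i) \<le> (\<Sum>i. ts_outer J T (A i)) + ennreal e" .
qed

lemma outer_measure_space_ts_outer:
  assumes "T \<noteq> {}" "\<forall>c. J c c = {}"
  shows "outer_measure_space (Pow T) (ts_outer J T)"
  unfolding outer_measure_space_def positive_def increasing_def countably_subadditive_def
  using ts_outer_empty[where J = J, OF assms] by (auto intro: ts_outer_mono ts_outer_countably_subadditive)

lemma ts_outer_Un:
  assumes "T \<noteq> {}" "\<forall>c. J c c = {}"
  shows "ts_outer J T (E \<union> F) \<le> ts_outer J T E + ts_outer J T F"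
proof -
  have "ts_outer J T (\<Union>i. binaryset E F i) \<le> (\<Sum>i. ts_outer J T (binaryset E F i))"
    by (rule ts_outer_countably_subadditive)
  also have "\<dots> = ts_outer J T E + ts_outer J T F"
    using binaryset_sums[of "ts_outer J T" E F] ts_outer_empty[where J = J, OF assms] by (simp add: sums_iff)
  finally show ?thesis by (simp add: UN_binaryset_eq)
qed

lemma ray_in_lambda_system:
  assumes T: "T \<noteq> {}" "\<forall>c. J c c = {}" and c: "c \<in> T"
    and J1: "\<And>u v. J u v \<inter> H \<subseteq> J (min u c) (min v c)"
    and J2: "\<And>u v. J u v - H \<subseteq> J (max u c) (max v c)"
  shows "H \<inter> T \<in> lambda_system T (Pow T) (ts_outer J T)"
  unfolding lambda_system_def
proof (intro CollectI conjI ballI antisym)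
  fix E assume E: "E \<in> Pow T"
  have "E = ((H \<inter> T) \<inter> E) \<union> ((T - H \<inter> T) \<inter> E)" using E by auto
  then show "ts_outer J T E \<le> ts_outer J T ((H \<inter> T) \<inter> E) + ts_outer J T ((T - H \<inter> T) \<inter> E)"
    using ts_outer_Un[where J = J, OF T] by metis
  show "ts_outer J T ((H \<inter> T) \<inter> E) + ts_outer J T ((T - H \<inter> T) \<inter> E) \<le> ts_outer J T E"
    unfolding ts_outer_def[of J T E]
  proof (rule INF_greatest)
    fix I assume I: "I \<in> ts_covers J T E"
    let ?L = "\<lambda>j. (min (fst (I j)) c, min (snd (I j)) c)"
    let ?R = "\<lambda>j. (max (fst (I j)) c, max (snd (I j)) c)"
    have mono: "fst (I j) \<le> snd (I j)" and inT: "fst (I j) \<in> T" "snd (I j) \<in> T" for j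
      using I by (auto simp: ts_covers_def)
    have cov: "\<exists>j. x \<in> J (fst (I j)) (snd (I j))" if "x \<in> E" for x
      using I that by (auto simp: ts_covers_def)
    have L: "?L \<in> ts_covers J T ((H \<inter> T) \<inter> E)"
    proof -
      have "(H \<inter> T) \<inter> E \<subseteq> (\<Union>j. J (fst (?L j)) (snd (?L j)))"
        using cov J1 by fastforce
      moreover have "min (fst (I j)) c \<in> T" "min (snd (I j)) c \<in> T" for j
        using inT c by (simp_all add: min_def)
      moreover have "min (fst (I j)) c \<le> min (snd (I j)) c" for j
        using mono[of j] by linarith
      ultimately show ?thesis by (simp add: ts_covers_def)
    qed
    have R: "?R \<in> ts_covers J T ((T - H \<inter> T) \<inter> E)"
    proof -
      have "(T - H \<inter> T) \<inter> E \<subseteq> (\<Union>j. J (fst (?R j)) (snd (?R j)))"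
        using cov J2 by fastforce
      moreover have "max (fst (I j)) c \<in> T" "max (snd (I j)) c \<in> T" for j
        using inT c by (simp_all add: max_def)
      moreover have "max (fst (I j)) c \<le> max (snd (I j)) c" for j
        using mono[of j] by linarith
      ultimately show ?thesis by (simp add: ts_covers_def)
    qed
    have "ts_outer J T ((H \<inter> T) \<inter> E) + ts_outer J T ((T - H \<inter> T) \<inter> E)
      \<le> (\<Sum>j. ennreal (snd (?L j) - fst (?L j))) + (\<Sum>j. ennreal (snd (?R j) - fst (?R j)))"
      by (intro add_mono ts_outer_le L R)
    also have "\<dots> = (\<Sum>j. ennreal (snd (?L j) - fst (?L j)) + ennreal (snd (?R j) - fst (?R j)))"
      by (rule suminf_add) auto
    also have "\<dots> = (\<Sum>j. ennreal (snd (I j) - fst (I j)))"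
    proof (rule suminf_cong)
      fix j
      show "ennreal (snd (?L j) - fst (?L j)) + ennreal (snd (?R j) - fst (?R j))
        = ennreal (snd (I j) - fst (I j))"
        using mono[of j] by (auto simp: min_def max_def simp flip: ennreal_plus)
    qed
    finally show "ts_outer J T ((H \<inter> T) \<inter> E) + ts_outer J T ((T - H \<inter> T) \<inter> E)
      \<le> (\<Sum>j. ennreal (snd (I j) - fst (I j)))" .
  qed
qed auto

lemma ts_measure_space:
  assumes "T \<noteq> {}" "\<forall>c. J c c = {}"
  shows "measure_space T (lambda_system T (Pow T) (ts_outer J T)) (ts_outer J T)"
  using sigma_algebra.caratheodory_lemma[OF sigma_algebra_Pow outer_measure_space_ts_outer[where J = J, OF assms]] .

lemma
  assumes "T \<noteq> {}" "\<forall>c. J c c = {}"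
  shows sets_ts_measure: "sets (ts_measure J T) = lambda_system T (Pow T) (ts_outer J T)"
    and emeasure_ts_measure:
      "X \<in> lambda_system T (Pow T) (ts_outer J T) \<Longrightarrow> emeasure (ts_measure J T) X = ts_outer J T X"
proof -
  interpret sigma_algebra T "lambda_system T (Pow T) (ts_outer J T)"
    using ts_measure_space[where J = J, OF assms] by (simp add: measure_space_def)
  show "sets (ts_measure J T) = lambda_system T (Pow T) (ts_outer J T)"
    unfolding ts_measure_def by (rule sets_measure_of_eq)
  show "X \<in> lambda_system T (Pow T) (ts_outer J T) \<Longrightarrow> emeasure (ts_measure J T) X = ts_outer J T X"
    unfolding ts_measure_def using ts_measure_space[where J = J, OF assms]
    by (intro emeasure_measure_of_sigma) (auto simp: measure_space_def sigma_algebra_axioms)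
qed

lemma le_ts_outer_J:
  assumes cd: "c \<le> d" and J: "\<And>u v. u \<le> v \<Longrightarrow> emeasure lborel (J u v) = ennreal (v - u)"
    and Jm: "\<And>u v. J u v \<in> sets lborel"
    and cov: "\<And>I. I \<in> ts_covers J T (J c d \<inter> T) \<Longrightarrow> J c d \<subseteq> (\<Union>j. J (fst (I j)) (snd (I j)))"
  shows "ennreal (d - c) \<le> ts_outer J T (J c d \<inter> T)"
  unfolding ts_outer_def
proof (rule INF_greatest)
  fix I assume I: "I \<in> ts_covers J T (J c d \<inter> T)"
  have "ennreal (d - c) = emeasure lborel (J c d)" using J cd by simp
  also have "\<dots> \<le> emeasure lborel (\<Union>j. J (fst (I j)) (snd (I j)))"
    using cov[OF I] Jm by (intro emeasure_mono) auto
  also have "\<dots> \<le> (\<Sum>j. emeasure lborel (J (fst (I j)) (snd (I j))))"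
    using Jm by (intro emeasure_subadditive_countably) auto
  also have "\<dots> = (\<Sum>j. ennreal (snd (I j) - fst (I j)))"
    using I by (intro suminf_cong J) (auto simp: ts_covers_def)
  finally show "ennreal (d - c) \<le> (\<Sum>j. ennreal (snd (I j) - fst (I j)))" .
qed

lemma delta_measure_interval:
  assumes T: "time_scale T" and cd: "c \<in> T" "d \<in> T" "c \<le> d"
  shows "{c..<d} \<inter> T \<in> sets (delta_measure T)"
    and "emeasure (delta_measure T) ({c..<d} \<inter> T) = ennreal (d - c)"
proof -
  let ?J = "\<lambda>c d::real. {c..<d}"
  have ne: "T \<noteq> {}" and cl: "closed T" and J0: "\<forall>c. ?J c c = {}"
    using T by (auto simp: time_scale_def)
  note S = sets_ts_measure[of T ?J, OF ne J0] and M = emeasure_ts_measure[of T ?J, OF ne J0]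
  have ray: "{..<x} \<inter> T \<in> sets (ts_measure ?J T)" if "x \<in> T" for x
    unfolding S by (rule ray_in_lambda_system[where J = ?J, OF ne J0 that]) auto
  have "{c..<d} \<inter> T = ({..<d} \<inter> T) - ({..<c} \<inter> T)" by auto
  with ray cd have in_sets: "{c..<d} \<inter> T \<in> sets (ts_measure ?J T)"
    by (metis sets.Diff)
  then show "{c..<d} \<inter> T \<in> sets (delta_measure T)" by (simp add: delta_measure_def)
  have "ennreal (d - c) \<le> ts_outer ?J T (?J c d \<inter> T)"
  proof (rule le_ts_outer_J[OF cd(3)])
    fix I assume I: "I \<in> ts_covers ?J T (?J c d \<inter> T)"
    show "?J c d \<subseteq> (\<Union>j. ?J (fst (I j)) (snd (I j)))"
    proof
      fix x assume x: "x \<in> ?J c d"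
      define s where "s = Sup (T \<inter> {..x})"
      have bdd: "bdd_above (T \<inter> {..x})" by (rule bdd_aboveI[of _ x]) auto
      have "s \<in> T \<inter> {..x}" unfolding s_def
        by (rule closed_contains_Sup) (use bdd x cd cl in \<open>auto intro: closed_Int\<close>)
      moreover have up: "y \<le> s" if "y \<in> T" "y \<le> x" for y
        unfolding s_def by (rule cSup_upper[OF _ bdd]) (use that in auto)
      ultimately have "s \<in> ?J c d \<inter> T" using x cd by auto
      then obtain j where j: "s \<in> ?J (fst (I j)) (snd (I j))" "snd (I j) \<in> T"
        using I by (auto simp: ts_covers_def)
      with up[of "snd (I j)"] \<open>s \<in> T \<inter> {..x}\<close> have "x \<in> ?J (fst (I j)) (snd (I j))" by force
      then show "x \<in> (\<Union>j. ?J (fst (I j)) (snd (I j)))" by blast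
    qed
  qed auto
  then show "emeasure (delta_measure T) ({c..<d} \<inter> T) = ennreal (d - c)"
    using ts_outer_J_le[OF cd, of ?J] M[of "{c..<d} \<inter> T"] in_sets S
    by (simp add: delta_measure_def antisym)
qed

lemma nabla_measure_interval:
  assumes T: "time_scale T" and cd: "c \<in> T" "d \<in> T" "c \<le> d"
  shows "{c<..d} \<inter> T \<in> sets (nabla_measure T)"
    and "emeasure (nabla_measure T) ({c<..d} \<inter> T) = ennreal (d - c)"
proof -
  let ?J = "\<lambda>c d::real. {c<..d}"
  have ne: "T \<noteq> {}" and cl: "closed T" and J0: "\<forall>c. ?J c c = {}"
    using T by (auto simp: time_scale_def)
  note S = sets_ts_measure[of T ?J, OF ne J0] and M = emeasure_ts_measure[of T ?J, OF ne J0]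
  have ray: "{..x} \<inter> T \<in> sets (ts_measure ?J T)" if "x \<in> T" for x
    unfolding S by (rule ray_in_lambda_system[where J = ?J, OF ne J0 that]) auto
  have "{c<..d} \<inter> T = ({..d} \<inter> T) - ({..c} \<inter> T)" by auto
  with ray cd have in_sets: "{c<..d} \<inter> T \<in> sets (ts_measure ?J T)"
    by (metis sets.Diff)
  then show "{c<..d} \<inter> T \<in> sets (nabla_measure T)" by (simp add: nabla_measure_def)
  have "ennreal (d - c) \<le> ts_outer ?J T (?J c d \<inter> T)"
  proof (rule le_ts_outer_J[OF cd(3)])
    fix I assume I: "I \<in> ts_covers ?J T (?J c d \<inter> T)"
    show "?J c d \<subseteq> (\<Union>j. ?J (fst (I j)) (snd (I j)))"
    proof
      fix x assume x: "x \<in> ?J c d"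
      define s where "s = Inf (T \<inter> {x..})"
      have bdd: "bdd_below (T \<inter> {x..})" by (rule bdd_belowI[of _ x]) auto
      have "s \<in> T \<inter> {x..}" unfolding s_def
        by (rule closed_contains_Inf) (use bdd x cd cl in \<open>auto intro: closed_Int\<close>)
      moreover have lo: "s \<le> y" if "y \<in> T" "x \<le> y" for y
        unfolding s_def by (rule cInf_lower[OF _ bdd]) (use that in auto)
      ultimately have "s \<in> ?J c d \<inter> T" using x cd by auto
      then obtain j where j: "s \<in> ?J (fst (I j)) (snd (I j))" "fst (I j) \<in> T"
        using I by (auto simp: ts_covers_def)
      with lo[of "fst (I j)"] \<open>s \<in> T \<inter> {x..}\<close> have "x \<in> ?J (fst (I j)) (snd (I j))" by force
      then show "x \<in> (\<Union>j. ?J (fst (I j)) (snd (I j)))" by blast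
    qed
  qed auto
  then show "emeasure (nabla_measure T) ({c<..d} \<inter> T) = ennreal (d - c)"
    using ts_outer_J_le[OF cd, of ?J] M[of "{c<..d} \<inter> T"] in_sets S
    by (simp add: nabla_measure_def antisym)
qed

end

theory Submission
  imports Defs
begin

text \<open>
  The refinement and reverse of Young's inequality due to Kittaneh and Manasrah,
  \<open>\<beta> (\<surd>x - \<surd>y)\<^sup>2 \<le> x/p + y/q - x\<^bsup>1/p\<^esup> y\<^bsup>1/q\<^esup> \<le> \<gamma> (\<surd>x - \<surd>y)\<^sup>2\<close>, is applied at each point with
  \<open>x = \<bar>f\<bar>\<^bsup>p\<^esup> / A\<close> and \<open>y = \<bar>g\<bar>\<^bsup>q\<^esup> / B\<close>. Multiplying by the weight \<open>K(t,s) \<bar>w(s)\<bar>\<close> and integrating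
  gives the claim divided by \<open>A\<^bsup>1/p\<^esup> B\<^bsup>1/q\<^esup>\<close>. Only linearity and positivity of the
  diamond integral are needed.
\<close>

lemma diamond_integrable_add:
  assumes "diamond_integrable T a b h" "diamond_integrable T a b k"
  shows "diamond_integrable T a b (\<lambda>s. h s + k s)"
  using assms
  by (auto simp: diamond_integrable_def delta_integrable_def nabla_integrable_def)

lemma diamond_integrable_mult_right:
  assumes "diamond_integrable T a b h"
  shows "diamond_integrable T a b (\<lambda>s. c * h s)"
  using assms
  by (auto simp: diamond_integrable_def delta_integrable_def nabla_integrable_def)

lemma diamond_integral_add:
  assumes "diamond_integrable T a b h" "diamond_integrable T a b k"
  shows "diamond_integral T \<alpha> a b (\<lambda>s. h s + k s)
    = diamond_integral T \<alpha> a b h + diamond_integral T \<alpha> a b k"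
  using assms
  by (simp add: diamond_integrable_def delta_integrable_def nabla_integrable_def
      diamond_integral_def delta_integral_def nabla_integral_def algebra_simps)

lemma diamond_integral_mult_right:
  "diamond_integral T \<alpha> a b (\<lambda>s. c * h s) = c * diamond_integral T \<alpha> a b h"
  by (simp add: diamond_integral_def delta_integral_def nabla_integral_def algebra_simps)

text \<open>Both half-open intervals of integration lie in \<open>{a..b} \<inter> T\<close>, so
  \<open>h\<close> times either indicator is nonnegative everywhere, and the weights
  \<open>\<alpha>\<close> and \<open>1 - \<alpha>\<close> are nonnegative as well.\<close>

lemma diamond_integral_nonneg:
  assumes "0 \<le> \<alpha>" "\<alpha> \<le> 1" and "\<And>s. s \<in> {a..b} \<inter> T \<Longrightarrow> 0 \<le> h s"
  shows "0 \<le> diamond_integral T \<alpha> a b h"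
  unfolding diamond_integral_def delta_integral_def nabla_integral_def set_lebesgue_integral_def
  using assms
  by (intro add_nonneg_nonneg mult_nonneg_nonneg Bochner_Integration.integral_nonneg)
    (auto simp: indicator_def)

text \<open>Carries a pointwise inequality between four integrands over to their integrals. Both
  bounds of the theorem are instances, with coefficients of either sign.\<close>

lemma diamond_integral_lincomb4_nonneg:
  assumes "0 \<le> \<alpha>" "\<alpha> \<le> 1"
    and int: "diamond_integrable T a b h\<^sub>1" "diamond_integrable T a b h\<^sub>2"
      "diamond_integrable T a b h\<^sub>3" "diamond_integrable T a b h\<^sub>4"
    and "\<And>s. s \<in> {a..b} \<inter> T \<Longrightarrow> 0 \<le> c\<^sub>1 * h\<^sub>1 s + (c\<^sub>2 * h\<^sub>2 s + (c\<^sub>3 * h\<^sub>3 s + c\<^sub>4 * h\<^sub>4 s))"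
  shows "0 \<le> c\<^sub>1 * diamond_integral T \<alpha> a b h\<^sub>1 + (c\<^sub>2 * diamond_integral T \<alpha> a b h\<^sub>2
    + (c\<^sub>3 * diamond_integral T \<alpha> a b h\<^sub>3 + c\<^sub>4 * diamond_integral T \<alpha> a b h\<^sub>4))"
proof -
  have "0 \<le> diamond_integral T \<alpha> a b
      (\<lambda>s. c\<^sub>1 * h\<^sub>1 s + (c\<^sub>2 * h\<^sub>2 s + (c\<^sub>3 * h\<^sub>3 s + c\<^sub>4 * h\<^sub>4 s)))"
    using assms by (intro diamond_integral_nonneg)
  then show ?thesis
    using int by (simp add: diamond_integral_add diamond_integral_mult_right
        diamond_integrable_add diamond_integrable_mult_right)
qed

text \<open>Extends \<open>Youngs_inequality_0\<close> to zero arguments: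
  \<open>0 powr u = 0\<close> for every \<open>u\<close>, even \<open>u = 0\<close>, so the left
  side vanishes there.\<close>

lemma weighted_am_gm:
  fixes u v x y :: real
  assumes "0 \<le> u" "0 \<le> v" "u + v = 1" "0 \<le> x" "0 \<le> y"
  shows "x powr u * y powr v \<le> u * x + v * y"
proof (cases "x = 0 \<or> y = 0")
  case True
  then show ?thesis using assms by auto
next
  case False
  then show ?thesis using assms Youngs_inequality_0[of u v x y] by auto
qed

text \<open>
  Each bound, with its terms moved to positive sides, is a weighted AM-GM inequality: with weights
  \<open>v - u\<close>, \<open>2u\<close> at \<open>y\<close>, \<open>\<surd>(xy)\<close>, respectively \<open>1/(2v)\<close>, \<open>(v - u)/(2v)\<close> at
  \<open>x\<^bsup>u\<^esup> y\<^bsup>v\<^esup>\<close>, \<open>x\<close>.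
\<close>

lemma young_refined_ordered:
  fixes u v x y :: real
  assumes uv: "0 < u" "u \<le> v" "u + v = 1" and xy: "0 \<le> x" "0 \<le> y"
  shows "u * (x + y - 2 * (sqrt x * sqrt y)) \<le> u * x + v * y - x powr u * y powr v"
    and "u * x + v * y - x powr u * y powr v \<le> v * (x + y - 2 * (sqrt x * sqrt y))"
proof -
  consider "x = 0 \<or> y = 0" | "0 < x" "0 < y" using xy by linarith
  then have "x powr u * y powr v \<le> (v - u) * y + 2 * u * (sqrt x * sqrt y) \<and>
    2 * v * (sqrt x * sqrt y) \<le> x powr u * y powr v + (v - u) * x"
  proof cases
    case 1
    then show ?thesis using uv xy by auto
  next
    case 2
    have "x powr u * y powr v = y powr (v - u) * (sqrt x * sqrt y) powr (2 * u)"
      using 2 by (simp add: powr_mult powr_half_sqrt[symmetric] powr_powr powr_diff)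
    also have "\<dots> \<le> (v - u) * y + 2 * u * (sqrt x * sqrt y)"
      using uv xy by (intro weighted_am_gm) auto
    finally have lower: "x powr u * y powr v \<le> (v - u) * y + 2 * u * (sqrt x * sqrt y)" .
    \<comment> \<open>These come from \<open>u + v = 1\<close>: by \<open>e1\<close> the exponents
      of \<open>x\<close> and \<open>y\<close> in the product below are both 1/2, and by
      \<open>e2\<close> the AM-GM weights add up to 1.\<close>
    have e1: "u * (1 / (2 * v)) + (v - u) / (2 * v) = 1 / 2" "v * (1 / (2 * v)) = 1 / 2"
      and e2: "1 / (2 * v) + (v - u) / (2 * v) = 1"
      using uv by (auto simp: field_simps)
    have "(x powr u * y powr v) powr (1 / (2 * v)) * x powr ((v - u) / (2 * v))
        = x powr (u * (1 / (2 * v)) + (v - u) / (2 * v)) * y powr (v * (1 / (2 * v)))"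
      using 2 by (simp only: powr_mult powr_powr powr_add powr_ge_zero mult_ac)
    then have "sqrt x * sqrt y
        = (x powr u * y powr v) powr (1 / (2 * v)) * x powr ((v - u) / (2 * v))"
      using 2 unfolding e1 by (simp add: powr_half_sqrt)
    also have "\<dots> \<le> 1 / (2 * v) * (x powr u * y powr v) + (v - u) / (2 * v) * x"
      using uv xy e2 by (intro weighted_am_gm) auto
    also have "\<dots> = (x powr u * y powr v + (v - u) * x) / (2 * v)"
      by (simp add: add_divide_distrib)
    finally have "2 * v * (sqrt x * sqrt y) \<le> x powr u * y powr v + (v - u) * x"
      using uv by (simp add: pos_le_divide_eq mult.commute)
    with lower show ?thesis ..
  qed
  then show "u * (x + y - 2 * (sqrt x * sqrt y)) \<le> u * x + v * y - x powr u * y powr v"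
    "u * x + v * y - x powr u * y powr v \<le> v * (x + y - 2 * (sqrt x * sqrt y))"
    by (auto simp: algebra_simps)
qed

text \<open>The claim is invariant under exchanging \<open>(u, x)\<close> with
  \<open>(v, y)\<close>, so the ordered case covers both orders of the weights.\<close>

lemma young_refined:
  fixes u v x y :: real
  assumes uv: "0 < u" "0 < v" "u + v = 1" and xy: "0 \<le> x" "0 \<le> y"
  shows "min u v * (x + y - 2 * (sqrt x * sqrt y)) \<le> u * x + v * y - x powr u * y powr v"
    and "u * x + v * y - x powr u * y powr v \<le> max u v * (x + y - 2 * (sqrt x * sqrt y))"
  using young_refined_ordered[of u v x y] young_refined_ordered[of v u y x] assms
  by (auto simp: min_def max_def ac_simps)

theorem theorem3p7:
  fixes T :: "real set" and a b t \<alpha> p q A B \<beta> \<gamma> :: real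
    and w f g :: "real \<Rightarrow> real" and K :: "real \<Rightarrow> real \<Rightarrow> real"
  assumes "time_scale T" and "a \<in> T" and "b \<in> T" and "a < b"
    and "t \<in> {a<..b} \<inter> T" and "0 \<le> \<alpha>" and "\<alpha> \<le> 1"
    and "continuous_on ({a..b} \<inter> T) w" and "continuous_on ({a..b} \<inter> T) f"
    and "continuous_on ({a..b} \<inter> T) g"
    and "diamond_integrable T a b w" and "diamond_integrable T a b f"
    and "diamond_integrable T a b g"
    and "\<And>x s. x \<in> {a..b} \<inter> T \<Longrightarrow> s \<in> {a..b} \<inter> T \<Longrightarrow> 0 \<le> K x s"
    and "p > 1" and "q > 1" and "1 / p + 1 / q = 1"
    and "kernel_op_exists T K a (\<lambda>s. \<bar>w s\<bar> * \<bar>f s\<bar> powr p) t"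
    and "kernel_op_exists T K a (\<lambda>s. \<bar>w s\<bar> * \<bar>g s\<bar> powr q) t"
    and "kernel_op_exists T K a (\<lambda>s. \<bar>w s\<bar> * \<bar>f s\<bar> powr (p / 2) * \<bar>g s\<bar> powr (q / 2)) t"
    and "kernel_op_exists T K a (\<lambda>s. \<bar>w s\<bar> * \<bar>f s\<bar> * \<bar>g s\<bar>) t"
    and "A = kernel_op T \<alpha> K a (\<lambda>s. \<bar>w s\<bar> * \<bar>f s\<bar> powr p) t" and "A > 0"
    and "B = kernel_op T \<alpha> K a (\<lambda>s. \<bar>w s\<bar> * \<bar>g s\<bar> powr q) t" and "B > 0"
    and "\<beta> = min (1 / p) (1 / q)" and "\<gamma> = max (1 / p) (1 / q)"
  shows
    "2 * \<beta> * (sqrt (A * B)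
        - kernel_op T \<alpha> K a (\<lambda>s. \<bar>w s\<bar> * \<bar>f s\<bar> powr (p / 2) * \<bar>g s\<bar> powr (q / 2)) t)
        * A powr (1 / p - 1 / 2) * B powr (1 / q - 1 / 2)
      \<le> A powr (1 / p) * B powr (1 / q) - kernel_op T \<alpha> K a (\<lambda>s. \<bar>w s\<bar> * \<bar>f s\<bar> * \<bar>g s\<bar>) t
     \<and> A powr (1 / p) * B powr (1 / q) - kernel_op T \<alpha> K a (\<lambda>s. \<bar>w s\<bar> * \<bar>f s\<bar> * \<bar>g s\<bar>) t
      \<le> 2 * \<gamma> * (sqrt (A * B)
        - kernel_op T \<alpha> K a (\<lambda>s. \<bar>w s\<bar> * \<bar>f s\<bar> powr (p / 2) * \<bar>g s\<bar> powr (q / 2)) t)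
        * A powr (1 / p - 1 / 2) * B powr (1 / q - 1 / 2)"
proof -
  define M R where "M = A powr (1 / p) * B powr (1 / q)" and "R = sqrt (A * B)"
  define C where
    "C = kernel_op T \<alpha> K a (\<lambda>s. \<bar>w s\<bar> * \<bar>f s\<bar> powr (p / 2) * \<bar>g s\<bar> powr (q / 2)) t"
  define D where "D = kernel_op T \<alpha> K a (\<lambda>s. \<bar>w s\<bar> * \<bar>f s\<bar> * \<bar>g s\<bar>) t"
  note AB = \<open>A > 0\<close> \<open>B > 0\<close> and pq = \<open>p > 1\<close> \<open>q > 1\<close> \<open>1 / p + 1 / q = 1\<close>
  have MR: "0 < M" "0 < R" using AB by (simp_all add: M_def R_def)
  \<comment> \<open>The trailing factor of both bounds: undoing the normalisation multiplies by
    \<open>M\<close>, while the mixed term \<open>C\<close> was normalised by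
    \<open>R\<close>.\<close>
  have norm: "A powr (1 / p - 1 / 2) * B powr (1 / q - 1 / 2) = M / R"
    using AB by (simp add: M_def R_def powr_diff powr_half_sqrt real_sqrt_mult)
  let ?\<phi>\<^sub>1 = "\<lambda>s. K t s * (\<bar>w s\<bar> * \<bar>f s\<bar> powr p)"
  let ?\<phi>\<^sub>2 = "\<lambda>s. K t s * (\<bar>w s\<bar> * \<bar>g s\<bar> powr q)"
  let ?\<phi>\<^sub>3 = "\<lambda>s. K t s * (\<bar>w s\<bar> * \<bar>f s\<bar> powr (p / 2) * \<bar>g s\<bar> powr (q / 2))"
  let ?\<phi>\<^sub>4 = "\<lambda>s. K t s * (\<bar>w s\<bar> * \<bar>f s\<bar> * \<bar>g s\<bar>)"
  have int: "diamond_integrable T a t ?\<phi>\<^sub>1" "diamond_integrable T a t ?\<phi>\<^sub>2"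
    "diamond_integrable T a t ?\<phi>\<^sub>3" "diamond_integrable T a t ?\<phi>\<^sub>4"
    using assms(18-21) by (simp_all add: kernel_op_exists_def)
  have I: "diamond_integral T \<alpha> a t ?\<phi>\<^sub>1 = A" "diamond_integral T \<alpha> a t ?\<phi>\<^sub>2 = B"
    "diamond_integral T \<alpha> a t ?\<phi>\<^sub>3 = C" "diamond_integral T \<alpha> a t ?\<phi>\<^sub>4 = D"
    using assms(22,24) by (simp_all add: kernel_op_def C_def D_def)
  \<comment> \<open>Young's bounds times the weight, sorted by integrand into the shape of
    \<open>diamond_integral_lincomb4_nonneg\<close>.\<close>
  have pointwise:
    "0 \<le> (1 / p - \<beta>) / A * ?\<phi>\<^sub>1 s + ((1 / q - \<beta>) / B * ?\<phi>\<^sub>2 s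
      + (2 * \<beta> / R * ?\<phi>\<^sub>3 s + - 1 / M * ?\<phi>\<^sub>4 s))" (is ?lower)
    "0 \<le> (\<gamma> - 1 / p) / A * ?\<phi>\<^sub>1 s + ((\<gamma> - 1 / q) / B * ?\<phi>\<^sub>2 s
      + (- 2 * \<gamma> / R * ?\<phi>\<^sub>3 s + 1 / M * ?\<phi>\<^sub>4 s))" (is ?upper)
    if s: "s \<in> {a..t} \<inter> T" for s
  proof -
    define x y where "x = \<bar>f s\<bar> powr p / A" and "y = \<bar>g s\<bar> powr q / B"
    have xy: "0 \<le> x" "0 \<le> y" using AB by (simp_all add: x_def y_def)
    \<comment> \<open>As \<open>t \<le> b\<close>, both \<open>t\<close> and \<open>s\<close> lie in
      \<open>{a..b} \<inter> T\<close>, where \<open>K\<close> is nonnegative.\<close>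
    have k: "0 \<le> K t s * \<bar>w s\<bar>" using assms(5,14) s by auto
    have "sqrt x * sqrt y = \<bar>f s\<bar> powr (p / 2) * \<bar>g s\<bar> powr (q / 2) / R"
      by (simp add: x_def y_def R_def real_sqrt_mult real_sqrt_divide powr_half_sqrt[symmetric]
          powr_powr)
    then have \<phi>\<^sub>3: "?\<phi>\<^sub>3 s / R = K t s * \<bar>w s\<bar> * (sqrt x * sqrt y)" by simp
    have "x powr (1 / p) * y powr (1 / q) = \<bar>f s\<bar> * \<bar>g s\<bar> / M"
      using AB pq by (simp add: x_def y_def M_def powr_divide powr_powr)
    then have \<phi>\<^sub>4: "?\<phi>\<^sub>4 s / M = K t s * \<bar>w s\<bar> * (x powr (1 / p) * y powr (1 / q))" by simp
    have \<phi>\<^sub>1: "?\<phi>\<^sub>1 s / A = K t s * \<bar>w s\<bar> * x" and \<phi>\<^sub>2: "?\<phi>\<^sub>2 s / B = K t s * \<bar>w s\<bar> * y"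
      by (simp_all add: x_def y_def)
    note young = young_refined[of "1 / p" "1 / q" x y, folded assms(26,27)]
    have "0 \<le> K t s * \<bar>w s\<bar> * (1 / p * x + 1 / q * y - x powr (1 / p) * y powr (1 / q)
        - \<beta> * (x + y - 2 * (sqrt x * sqrt y)))"
      using young(1) pq xy by (intro mult_nonneg_nonneg[OF k]) auto
    also have "\<dots> = (1 / p - \<beta>) * (?\<phi>\<^sub>1 s / A) + ((1 / q - \<beta>) * (?\<phi>\<^sub>2 s / B)
        + (2 * \<beta> * (?\<phi>\<^sub>3 s / R) + - 1 * (?\<phi>\<^sub>4 s / M)))"
      unfolding \<phi>\<^sub>1 \<phi>\<^sub>2 \<phi>\<^sub>3 \<phi>\<^sub>4 by (simp add: algebra_simps)
    finally show ?lower by simp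
    have "0 \<le> K t s * \<bar>w s\<bar> * (\<gamma> * (x + y - 2 * (sqrt x * sqrt y))
        - (1 / p * x + 1 / q * y - x powr (1 / p) * y powr (1 / q)))"
      using young(2) pq xy by (intro mult_nonneg_nonneg[OF k]) auto
    also have "\<dots> = (\<gamma> - 1 / p) * (?\<phi>\<^sub>1 s / A) + ((\<gamma> - 1 / q) * (?\<phi>\<^sub>2 s / B)
        + (- 2 * \<gamma> * (?\<phi>\<^sub>3 s / R) + 1 * (?\<phi>\<^sub>4 s / M)))"
      unfolding \<phi>\<^sub>1 \<phi>\<^sub>2 \<phi>\<^sub>3 \<phi>\<^sub>4 by (simp add: algebra_simps)
    finally show ?upper by simp
  qed
  have "0 \<le> (1 / p - \<beta>) / A * A + ((1 / q - \<beta>) / B * B + (2 * \<beta> / R * C + - 1 / M * D))"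
    using diamond_integral_lincomb4_nonneg[OF assms(6,7) int pointwise(1)] unfolding I by blast
  \<comment> \<open>The first two terms sum to
    \<open>1 / p + 1 / q - 2 * \<beta> = 1 - 2 * \<beta>\<close>; the factor \<open>M > 0\<close>
    then clears the normalisation.\<close>
  then have "0 \<le> M * (1 - 2 * \<beta> + 2 * \<beta> / R * C - D / M)"
    using AB MR pq by (intro mult_nonneg_nonneg) auto
  also have "M * (1 - 2 * \<beta> + 2 * \<beta> / R * C - D / M)
      = M - D - 2 * \<beta> * (R - C) * (M / R)"
    using MR by (simp add: field_simps)
  finally have lower: "2 * \<beta> * (R - C) * (M / R) \<le> M - D"
    by simp
  have "0 \<le> (\<gamma> - 1 / p) / A * A + ((\<gamma> - 1 / q) / B * B + (- 2 * \<gamma> / R * C + 1 / M * D))"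
    using diamond_integral_lincomb4_nonneg[OF assms(6,7) int pointwise(2)] unfolding I by blast
  \<comment> \<open>Here the conjugacy of \<open>p\<close> and \<open>q\<close> turns the first two
    terms into \<open>2 * \<gamma> - 1\<close>.\<close>
  then have "0 \<le> M * (2 * \<gamma> - 1 - 2 * \<gamma> / R * C + D / M)"
    using AB MR pq by (intro mult_nonneg_nonneg) auto
  also have "M * (2 * \<gamma> - 1 - 2 * \<gamma> / R * C + D / M)
      = 2 * \<gamma> * (R - C) * (M / R) - (M - D)"
    using MR by (simp add: field_simps)
  finally have upper: "M - D \<le> 2 * \<gamma> * (R - C) * (M / R)"
    by simp
  show ?thesis
    using lower upper
    unfolding norm[symmetric] unfolding M_def R_def C_def D_def by (simp add: mult.assoc)
qed

end
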